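(* Let $k$ be a positive rational number with $k\neq 1$, and set \[ a=\big((k^4 + 1)^2 - 4k^2(k^2 + 1)^2\big)^2,\quad b=8k(k^2 + 1)(k^4 + 1)\big((k^4 + 1)^2 - 4k^2(k^2 - 1)^2\big),\quad c=\big((k^4 + 1)^2 + 4k^2(k^2 - 1)^2\big)^2. \] Then $a,b,c$ are the side lengths of a triangle with rational area, and after appropriate scaling by a positive rational factor this triangle becomes a primitive Heron triangle whose two sides corresponding to $a$ and $c$ are perfect squares of integers. Thus $(a,b,c)$ gives a parametric family of primitive Heron triangles with two perfect square sides.
   Context: A Heron triangle is a (non-degenerate) triangle whose three side lengths and whose area are all positive integers; it is primitive if the greatest common divisor of its three side lengths is $1$. *)

theory Defs
  imports "HOL-Analysis.Analysis"
begin

text \<open>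
  Sides are named by the opposite vertex: \<open>a = QR\<close>, \<open>b = RP\<close>, \<open>c = PQ\<close>.
\<close>

definition triangle_with_sides ::
  "real^2 \<Rightarrow> real^2 \<Rightarrow> real^2 \<Rightarrow> real \<Rightarrow> real \<Rightarrow> real \<Rightarrow> bool" where
  "triangle_with_sides P Q R a b c \<longleftrightarrow>
     \<not> collinear {P, Q, R} \<and> dist Q R = a \<and> dist R P = b \<and> dist P Q = c"

definition triangle_area :: "real^2 \<Rightarrow> real^2 \<Rightarrow> real^2 \<Rightarrow> real" where
  "triangle_area P Q R = measure lborel (convex hull {P, Q, R})"

definition heron_triangle ::
  "real^2 \<Rightarrow> real^2 \<Rightarrow> real^2 \<Rightarrow> int \<Rightarrow> int \<Rightarrow> int \<Rightarrow> bool" where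
  "heron_triangle P Q R x y z \<longleftrightarrow>
     triangle_with_sides P Q R (of_int x) (of_int y) (of_int z) \<and>
     x > 0 \<and> y > 0 \<and> z > 0 \<and>
     (\<exists>S::int. S > 0 \<and> triangle_area P Q R = of_int S)"

definition primitive_heron_triangle ::
  "real^2 \<Rightarrow> real^2 \<Rightarrow> real^2 \<Rightarrow> int \<Rightarrow> int \<Rightarrow> int \<Rightarrow> bool" where
  "primitive_heron_triangle P Q R x y z \<longleftrightarrow>
     heron_triangle P Q R x y z \<and> Gcd {x, y, z} = 1"

end

theory Submission
  imports Defs
begin

text \<open>
  Put \<open>u = k\<^sup>4 + 1\<close>, \<open>v = 2k(k\<^sup>2 + 1)\<close>, \<open>w = 2k(k\<^sup>2 - 1)\<close>. Then \<open>a = (u\<^sup>2 - v\<^sup>2)\<^sup>2\<close>,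
  \<open>b = 4uv(u\<^sup>2 - w\<^sup>2)\<close>, \<open>c = (u\<^sup>2 + w\<^sup>2)\<^sup>2\<close>, and the four factors in Heron's formula split as
  \<open>a + b + c = 2(u\<^sup>2 - w\<^sup>2)(u + v)\<^sup>2\<close>, \<open>a + c - b = 2(u\<^sup>2 - w\<^sup>2)(u - v)\<^sup>2\<close>,
  \<open>b + c - a = 8ku(k - 1)\<^sup>2(u + v)\<^sup>2\<close>, \<open>a + b - c = 8ku(k + 1)\<^sup>2(u - v)\<^sup>2\<close>,
  so the area is \<open>2\<bar>w\<bar>u(u\<^sup>2 - w\<^sup>2)(u\<^sup>2 - v\<^sup>2)\<^sup>2\<close>.
  For \<open>k = p/q\<close> in lowest terms, clearing denominators turns \<open>u\<close>, \<open>v\<close>, \<open>w\<close> into integers for which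
  the gcd of \<open>u\<^sup>2 - v\<^sup>2\<close> and \<open>u\<^sup>2 + w\<^sup>2\<close> is \<open>4\<close> if \<open>p\<close> and \<open>q\<close> are both odd and \<open>1\<close> otherwise;
  dividing the sides by the square of this gcd leaves \<open>a\<close> and \<open>c\<close> coprime squares, and \<open>b\<close> and
  the area integral. The same parity count shows \<open>u \<noteq> v\<close>, so the triangle is not degenerate.
\<close>

section \<open>Plane triangles: existence, scaling and area\<close>

lemma triangle_with_sides_exists:
  fixes a b c :: real
  assumes "a < b + c" "b < a + c" "c < a + b"
  shows "\<exists>P Q R. triangle_with_sides P Q R a b c"
proof -
  have pos: "a > 0" "b > 0" "c > 0"
    using assms by auto
  \<comment> \<open>The apex \<open>R\<close> is placed over the base \<open>PQ\<close> on the first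
    axis; the law of cosines gives its abscissa \<open>x\<close>, possibly negative.\<close>
  define x where "x = (b\<^sup>2 + c\<^sup>2 - a\<^sup>2) / (2 * c)"
  define y where "y = sqrt (b\<^sup>2 - x\<^sup>2)"
  have cx: "2 * c * x = b\<^sup>2 + c\<^sup>2 - a\<^sup>2"
    using pos by (simp add: x_def)
  \<comment> \<open>Both sides equal 16 times the squared area, so the strict triangle inequalities
    make the height real and nonzero.\<close>
  have "4 * c\<^sup>2 * (b\<^sup>2 - x\<^sup>2) = (2 * b * c)\<^sup>2 - (2 * c * x)\<^sup>2"
    by (simp add: power2_eq_square algebra_simps)
  also have "\<dots> = (a + b + c) * (b + c - a) * ((a + c - b) * (a + b - c))"
    unfolding cx by (simp add: power2_eq_square algebra_simps)
  also have "\<dots> > 0"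
    using assms pos by (intro mult_pos_pos) auto
  finally have "b\<^sup>2 - x\<^sup>2 > 0"
    using pos by (simp add: zero_less_mult_iff)
  then have y2: "y\<^sup>2 = b\<^sup>2 - x\<^sup>2"
    by (simp add: y_def)
  define P Q R :: "real^2" where "P = 0" and "Q = vector [c, 0]" and "R = vector [x, y]"
  have dist2: "dist A B = sqrt ((A $ 1 - B $ 1)\<^sup>2 + (A $ 2 - B $ 2)\<^sup>2)" for A B :: "real^2"
    by (simp add: dist_vec_def L2_set_def sum_2 dist_real_def)
  have "(c - x)\<^sup>2 + y\<^sup>2 = a\<^sup>2"
    using cx y2 by (simp add: power2_eq_square algebra_simps)
  then have QR: "dist Q R = a"
    using pos by (simp add: dist2 Q_def R_def)
  have RP: "dist R P = b" and PQ: "dist P Q = c"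
    using pos by (simp_all add: dist2 P_def Q_def R_def y2)
  have "\<not> collinear {P, Q, R}"
    using assms QR RP PQ by (auto simp: collinear_between_cases between dist_commute)
  with QR RP PQ show ?thesis
    unfolding triangle_with_sides_def by blast
qed

lemma collinear_scaleR_image:
  fixes S :: "'a::real_vector set"
  assumes "collinear S"
  shows "collinear ((*\<^sub>R) r ` S)"
proof -
  obtain d where d: "\<And>x y. x \<in> S \<Longrightarrow> y \<in> S \<Longrightarrow> \<exists>t. x - y = t *\<^sub>R d"
    using assms unfolding collinear_def by blast
  have "\<exists>t. r *\<^sub>R x - r *\<^sub>R y = t *\<^sub>R d" if "x \<in> S" "y \<in> S" for x y
    using d[OF that] by (metis scaleR_right_diff_distrib scaleR_scaleR)
  then show ?thesis
    unfolding collinear_def by blast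
qed

lemma triangle_with_sides_scaleR:
  assumes "triangle_with_sides P Q R a b c" and "r > 0"
  shows "triangle_with_sides (r *\<^sub>R P) (r *\<^sub>R Q) (r *\<^sub>R R) (r * a) (r * b) (r * c)"
  \<comment> \<open>If the scaled points were collinear, scaling back by \<open>inverse r\<close>
    would make the original ones collinear.\<close>
  using assms collinear_scaleR_image[of "{r *\<^sub>R P, r *\<^sub>R Q, r *\<^sub>R R}" "inverse r"]
  by (auto simp: triangle_with_sides_def dist_norm simp flip: scaleR_right_diff_distrib)

lemma triangle_area_heron:
  assumes "triangle_with_sides P Q R a b c"
  shows "triangle_area P Q R = sqrt ((a + b + c) * (b + c - a) * (a + c - b) * (a + b - c)) / 4"
proof -
  define s where "s = (a + b + c) / 2"
  have "triangle_area P Q R = sqrt (s * (s - a) * (s - b) * (s - c))"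
    using assms heron[of P Q R]
    by (simp add: triangle_area_def triangle_with_sides_def s_def dist_commute measure_completion)
  also have "s * (s - a) * (s - b) * (s - c)
      = (a + b + c) * (b + c - a) * (a + c - b) * (a + b - c) / 4\<^sup>2"
    by (simp add: s_def field_simps)
  finally show ?thesis
    by (simp add: real_sqrt_divide)
qed

text \<open>The radicand in Heron's formula is homogeneous of degree 4 in the sides.\<close>

lemma triangle_area_scaleR:
  assumes "triangle_with_sides P Q R a b c" and "r > 0"
  shows "triangle_area (r *\<^sub>R P) (r *\<^sub>R Q) (r *\<^sub>R R) = r\<^sup>2 * triangle_area P Q R"
proof -
  define H where "H = (a + b + c) * (b + c - a) * (a + c - b) * (a + b - c)"
  have "(r * a + r * b + r * c) * (r * b + r * c - r * a) * (r * a + r * c - r * b)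
      * (r * a + r * b - r * c) = (r\<^sup>2)\<^sup>2 * H"
    unfolding H_def by algebra
  then have "triangle_area (r *\<^sub>R P) (r *\<^sub>R Q) (r *\<^sub>R R) = sqrt ((r\<^sup>2)\<^sup>2 * H) / 4"
    by (simp add: triangle_area_heron[OF triangle_with_sides_scaleR[OF assms]])
  also have "\<dots> = r\<^sup>2 * (sqrt H / 4)"
    using real_sqrt_abs[of "r\<^sup>2"] by (simp add: real_sqrt_mult)
  finally show ?thesis
    by (simp add: triangle_area_heron[OF assms(1)] H_def)
qed

section \<open>Algebra and signs of the Heron factors\<close>

lemma heron_factors:
  fixes k :: real
  defines "u \<equiv> k^4 + 1" and "v \<equiv> 2 * k * (k\<^sup>2 + 1)" and "w \<equiv> 2 * k * (k\<^sup>2 - 1)"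
  defines "a \<equiv> (u\<^sup>2 - v\<^sup>2)\<^sup>2" and "b \<equiv> 4 * u * v * (u\<^sup>2 - w\<^sup>2)" and "c \<equiv> (u\<^sup>2 + w\<^sup>2)\<^sup>2"
  shows "a + b + c = 2 * (u\<^sup>2 - w\<^sup>2) * (u + v)\<^sup>2"
    and "a + c - b = 2 * (u\<^sup>2 - w\<^sup>2) * (u - v)\<^sup>2"
    and "b + c - a = 8 * k * u * (k - 1)\<^sup>2 * (u + v)\<^sup>2"
    and "a + b - c = 8 * k * u * (k + 1)\<^sup>2 * (u - v)\<^sup>2"
  unfolding a_def b_def c_def u_def v_def w_def by algebra+

lemma square_diff_pos:
  fixes k :: real
  assumes "k > 0"
  shows "(k^4 + 1)\<^sup>2 - (2 * k * (k\<^sup>2 - 1))\<^sup>2 > 0"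
proof -
  \<comment> \<open>The factors are \<open>u - w\<close> and \<open>u + w\<close>, each written as a
    sum of two squares.\<close>
  have "(k^4 + 1)\<^sup>2 - (2 * k * (k\<^sup>2 - 1))\<^sup>2 = ((k\<^sup>2 - k - 1)\<^sup>2 + k\<^sup>2) * ((k\<^sup>2 + k - 1)\<^sup>2 + k\<^sup>2)"
    by algebra
  also have "\<dots> > 0"
    using assms by (intro mult_pos_pos add_nonneg_pos) auto
  finally show ?thesis .
qed

section \<open>Common divisors after clearing denominators\<close>

text \<open>An odd prime \<open>l\<close> dividing both numbers divides their difference
  \<open>V^2 + W^2\<close>, which is \<open>8 * p^2 * q^2 * U\<close>. Each case leads to
  \<open>l dvd U\<close>, hence to \<open>l\<close> dividing \<open>V\<close> and \<open>W\<close>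
  but neither \<open>p\<close> nor \<open>q\<close>. Then \<open>l\<close> divides both the sum and
  the difference of the squares of \<open>p\<close> and \<open>q\<close>, which is
  impossible.\<close>

lemma prime_common_divisor_eq_2:
  fixes p q l :: int
  defines "U \<equiv> p^4 + q^4" and "V \<equiv> 2 * p * q * (p\<^sup>2 + q\<^sup>2)" and "W \<equiv> 2 * p * q * (p\<^sup>2 - q\<^sup>2)"
  assumes "coprime p q" and "prime l" and N: "l dvd U\<^sup>2 - V\<^sup>2" and M: "l dvd U\<^sup>2 + W\<^sup>2"
  shows "l = 2"
proof (rule ccontr)
  assume "l \<noteq> 2"
  then have no2: "\<not> l dvd 2"
    using \<open>prime l\<close> primes_dvd_imp_eq two_is_prime by blast
  have np: "\<not> (l dvd p \<and> l dvd q)"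
    using assms(4) \<open>prime l\<close> by (meson coprime_common_divisor not_prime_unit)
  have "(U\<^sup>2 + W\<^sup>2) - (U\<^sup>2 - V\<^sup>2) = 2^3 * p\<^sup>2 * q\<^sup>2 * U"
    unfolding U_def V_def W_def by algebra
  then have "l dvd 2^3 * p\<^sup>2 * q\<^sup>2 * U"
    using dvd_diff[OF M N] by simp
  then consider "l dvd p" | "l dvd q" | "l dvd U"
    using no2 \<open>prime l\<close> prime_dvd_power[of l 2 3]
    by (auto simp: prime_dvd_mult_iff prime_dvd_power_iff)
  moreover have dvd_power: "l dvd n ^ m \<longleftrightarrow> l dvd n" if "m > 0" for n m
    using that \<open>prime l\<close> by (simp add: prime_dvd_power_iff)
  have UV: "l dvd U \<longleftrightarrow> l dvd V"
    using N dvd_add_right_iff[OF N, of "V\<^sup>2"] by (simp add: dvd_power)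
  have UW: "l dvd U \<longleftrightarrow> l dvd W"
    using M dvd_diff_right_iff[of l "U\<^sup>2 + W\<^sup>2" "W\<^sup>2"] by (simp add: dvd_power)
  have Up: "l dvd U \<Longrightarrow> l dvd p \<longleftrightarrow> l dvd q"
    unfolding U_def using dvd_add_right_iff[of l "p^4" "q^4"] dvd_add_left_iff[of l "q^4" "p^4"]
    by (auto simp: dvd_power)
  \<comment> \<open>A prime dividing \<open>p\<close> or \<open>q\<close> divides \<open>V\<close>,
    hence \<open>U\<close>, so all three cases merge.\<close>
  moreover have "l dvd U" if "l dvd p \<or> l dvd q"
    using that unfolding UV by (auto simp: V_def)
  ultimately have "l dvd U" by blast
  with Up np have nn: "\<not> l dvd p" "\<not> l dvd q" by auto
  have "l dvd V" "l dvd W"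
    using \<open>l dvd U\<close> UV UW by auto
  then have "l dvd p\<^sup>2 + q\<^sup>2" "l dvd p\<^sup>2 - q\<^sup>2"
    using nn no2 \<open>prime l\<close> by (auto simp: V_def W_def prime_dvd_mult_iff)
  then have "l dvd (p\<^sup>2 + q\<^sup>2) + (p\<^sup>2 - q\<^sup>2)"
    by (rule dvd_add)
  then have "l dvd 2 * p\<^sup>2" by simp
  then show False
    using nn no2 \<open>prime l\<close> by (simp add: prime_dvd_mult_iff dvd_power)
qed

text \<open>The square roots of two sides are divided by \<open>s\<close>, so the sides are divided
  by \<open>s^2\<close> and the area by \<open>s^4\<close>. Here \<open>t\<close> is a signed area:
  it takes the sign of \<open>W\<close> into account.\<close>

lemma primitive_scaling:
  fixes p q :: int
  defines "U \<equiv> p^4 + q^4" and "V \<equiv> 2 * p * q * (p\<^sup>2 + q\<^sup>2)" and "W \<equiv> 2 * p * q * (p\<^sup>2 - q\<^sup>2)"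
  assumes "coprime p q"
  obtains s x y z t where "s > 0" "U\<^sup>2 - V\<^sup>2 = s * x" "U\<^sup>2 + W\<^sup>2 = s * z"
    "4 * U * V * (U\<^sup>2 - W\<^sup>2) = s\<^sup>2 * y" "2 * W * U * (U\<^sup>2 - W\<^sup>2) * (U\<^sup>2 - V\<^sup>2)\<^sup>2 = s^4 * t"
    "coprime x z" "x \<noteq> 0"
proof -
  \<comment> \<open>A common prime factor could only be 2, so an odd \<open>x\<close>
    suffices.\<close>
  have cop: "coprime x z"
    if "odd x" "U\<^sup>2 - V\<^sup>2 = s * x" "U\<^sup>2 + W\<^sup>2 = s * z" for s x z :: int
  proof (rule ccontr)
    assume "\<not> coprime x z"
    moreover have "gcd x z \<noteq> 0" using \<open>odd x\<close> by auto
    ultimately obtain l where "prime l" "l dvd gcd x z"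
      by (metis coprime_iff_gcd_eq_1 gcd_ge_0_int is_unit_gcd prime_divisor_exists)
    then have "l dvd x" "l dvd U\<^sup>2 - V\<^sup>2" "l dvd U\<^sup>2 + W\<^sup>2"
      using that by auto
    then have "l = 2"
      using prime_common_divisor_eq_2[OF assms(4) \<open>prime l\<close>] by (simp add: U_def V_def W_def)
    with \<open>l dvd x\<close> \<open>odd x\<close> show False by simp
  qed
  show thesis
  proof (cases "odd p \<and> odd q")
    case False
    with assms(4) have "odd p \<noteq> odd q"
      by (metis coprime_common_divisor odd_one)
    then have "odd (U\<^sup>2 - V\<^sup>2)"
      by (auto simp: U_def V_def)
    moreover from this have "U\<^sup>2 - V\<^sup>2 \<noteq> 0"
      by (metis even_zero)
    ultimately show thesis
      by (intro that[of 1 "U\<^sup>2 - V\<^sup>2" "U\<^sup>2 + W\<^sup>2"] cop[of _ 1])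
        simp_all
  next
    case True
    then obtain i j where ij: "p = 2 * i + 1" "q = 2 * j + 1"
      by (meson oddE)
    \<comment> \<open>Odd squares are 1 modulo 4, so half the sum of the two squares is odd and half
      their difference is even. This makes \<open>e = U / 2\<close> odd, and with it
      \<open>x\<close>.\<close>
    define m n where "m = 2 * (i\<^sup>2 + i + j\<^sup>2 + j) + 1" and "n = 2 * (i\<^sup>2 + i - j\<^sup>2 - j)"
    have mn: "p\<^sup>2 + q\<^sup>2 = 2 * m" "p\<^sup>2 - q\<^sup>2 = 2 * n"
      unfolding ij m_def n_def by algebra+
    define e where "e = m\<^sup>2 + n\<^sup>2"
    have U: "U = 2 * e"
    proof -
      have "2 * U = (p\<^sup>2 + q\<^sup>2)\<^sup>2 + (p\<^sup>2 - q\<^sup>2)\<^sup>2"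
        unfolding U_def by algebra
      then show ?thesis unfolding mn e_def by (simp add: power2_eq_square)
    qed
    have "odd e" by (simp add: e_def m_def n_def)
    have V: "V = 4 * p * q * m" and W: "W = 4 * p * q * n"
      by (simp_all add: V_def W_def mn)
    define x z where "x = e\<^sup>2 - 4 * (p * q * m)\<^sup>2" and "z = e\<^sup>2 + 4 * (p * q * n)\<^sup>2"
    have x: "U\<^sup>2 - V\<^sup>2 = 4 * x" and z: "U\<^sup>2 + W\<^sup>2 = 4 * z"
      unfolding U V W x_def z_def by algebra+
    have "odd x" using \<open>odd e\<close> by (simp add: x_def)
    show thesis
    proof (rule that)
      show "(4::int) > 0" by simp
      show "4 * U * V * (U\<^sup>2 - W\<^sup>2) = 4\<^sup>2 * (2 * e * p * q * m * (U\<^sup>2 - W\<^sup>2))"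
        unfolding U V by simp
      \<comment> \<open>The factor \<open>2 * W * U\<close> supplies \<open>4^2\<close>, and the
        squared difference \<open>(4 * x)^2\<close> supplies the other \<open>4^2\<close>.\<close>
      show "2 * W * U * (U\<^sup>2 - W\<^sup>2) * (U\<^sup>2 - V\<^sup>2)\<^sup>2 = 4^4 * (p * q * n * e * (U\<^sup>2 - W\<^sup>2) * x\<^sup>2)"
        unfolding x by (simp add: U W power2_eq_square)
      show "x \<noteq> 0" using \<open>odd x\<close> by auto
    qed (use x z cop[OF \<open>odd x\<close> x z] in auto)
  qed
qed

section \<open>The triangle for rational \<open>k\<close> and its primitive multiple\<close>

theorem theorem1p4:
  fixes k a b c :: real
  assumes "k \<in> \<rat>" and "k > 0" and "k \<noteq> 1"
    and "a = ((k^4 + 1)^2 - 4 * k^2 * (k^2 + 1)^2)^2"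
    and "b = 8 * k * (k^2 + 1) * (k^4 + 1) * ((k^4 + 1)^2 - 4 * k^2 * (k^2 - 1)^2)"
    and "c = ((k^4 + 1)^2 + 4 * k^2 * (k^2 - 1)^2)^2"
  shows "(\<exists>P Q R. triangle_with_sides P Q R a b c) \<and>
    (\<forall>P Q R. triangle_with_sides P Q R a b c \<longrightarrow>
       triangle_area P Q R \<in> \<rat> \<and>
       (\<exists>r\<in>\<rat>. r > 0 \<and>
          (\<exists>x y z. primitive_heron_triangle (r *\<^sub>R P) (r *\<^sub>R Q) (r *\<^sub>R R) x y z \<and>
             (\<exists>m::int. x = m^2) \<and> (\<exists>n::int. z = n^2))))"
proof -
  define u v w where "u = k^4 + 1" and "v = 2 * k * (k\<^sup>2 + 1)" and "w = 2 * k * (k\<^sup>2 - 1)"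
  have a: "a = (u\<^sup>2 - v\<^sup>2)\<^sup>2" and b: "b = 4 * u * v * (u\<^sup>2 - w\<^sup>2)" and c: "c = (u\<^sup>2 + w\<^sup>2)\<^sup>2"
    unfolding assms(4-6) u_def v_def w_def by algebra+
  have upos: "u > 0" and vpos: "v > 0"
    using \<open>k > 0\<close> by (simp_all add: u_def v_def add_pos_pos)
  have D: "u\<^sup>2 - w\<^sup>2 > 0"
    using square_diff_pos[OF \<open>k > 0\<close>] by (simp add: u_def w_def)
  have w0: "w \<noteq> 0"
    using \<open>k > 0\<close> \<open>k \<noteq> 1\<close> by (auto simp: w_def power2_eq_1_iff)

  obtain p' q' :: nat where q': "q' \<noteq> 0" and k': "\<bar>k\<bar> = real p' / real q'" and "coprime p' q'"
    using Rats_abs_nat_div_natE[OF \<open>k \<in> \<rat>\<close>] by metis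
  define p q where "p = int p'" and "q = int q'"
  define U V W where "U = p^4 + q^4" and "V = 2 * p * q * (p\<^sup>2 + q\<^sup>2)" and "W = 2 * p * q * (p\<^sup>2 - q\<^sup>2)"
  have q: "real_of_int q > 0" and k: "k = real_of_int p / real_of_int q" and "coprime p q"
    using q' k' \<open>coprime p' q'\<close> \<open>k > 0\<close> by (simp_all add: p_def q_def)
  obtain s x y z t where s: "s > 0" and x: "U\<^sup>2 - V\<^sup>2 = s * x" and z: "U\<^sup>2 + W\<^sup>2 = s * z"
    and y: "4 * U * V * (U\<^sup>2 - W\<^sup>2) = s\<^sup>2 * y"
    and t: "2 * W * U * (U\<^sup>2 - W\<^sup>2) * (U\<^sup>2 - V\<^sup>2)\<^sup>2 = s^4 * t"
    and "coprime x z" and "x \<noteq> 0"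
    using primitive_scaling[OF \<open>coprime p q\<close>] unfolding U_def V_def W_def by metis
  \<comment> \<open>\<open>U\<close>, \<open>V\<close>, \<open>W\<close> are the degree 4
    homogenisations of \<open>u\<close>, \<open>v\<close>, \<open>w\<close>, so each gains the
    factor \<open>q^4\<close>.\<close>
  define d where "d = real_of_int q ^ 4"
  have d: "d > 0" using q by (simp add: d_def)
  have U: "real_of_int U = d * u" and V: "real_of_int V = d * v" and W: "real_of_int W = d * w"
    using q by (simp_all add: U_def V_def W_def u_def v_def w_def d_def k field_simps eval_nat_numeral)
  have rx: "real_of_int s * real_of_int x = d\<^sup>2 * (u\<^sup>2 - v\<^sup>2)"
    unfolding of_int_mult[symmetric] x[symmetric] by (simp add: U V W) algebra
  have rz: "real_of_int s * real_of_int z = d\<^sup>2 * (u\<^sup>2 + w\<^sup>2)"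
    unfolding of_int_mult[symmetric] z[symmetric] by (simp add: U V W) algebra
  have ry: "(real_of_int s)\<^sup>2 * real_of_int y = d^4 * b"
    unfolding of_int_mult[symmetric] of_int_power[symmetric] y[symmetric] b
    by (simp add: U V W) algebra
  have rt: "real_of_int s ^ 4 * real_of_int t = d^8 * (2 * w * u * (u\<^sup>2 - w\<^sup>2) * (u\<^sup>2 - v\<^sup>2)\<^sup>2)"
    unfolding of_int_mult[symmetric] of_int_power[symmetric] t[symmetric]
    by (simp add: U V W) algebra
  \<comment> \<open>Nondegeneracy is arithmetic: \<open>u = v\<close> does have positive real
    solutions, those with \<open>k + 1/k = 1 + sqrt 3\<close>, but no rational ones.\<close>
  have A0: "u\<^sup>2 - v\<^sup>2 \<noteq> 0"
    using rx s \<open>x \<noteq> 0\<close> by auto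
  then have uv: "u \<noteq> v" by auto

  note F = heron_factors[of k, folded u_def v_def w_def, folded a b c]
  have exists: "\<exists>P Q R. triangle_with_sides P Q R a b c"
  proof (rule triangle_with_sides_exists)
    have "b + c - a > 0" "a + c - b > 0" "a + b - c > 0"
      unfolding F(2-4) using D uv upos vpos \<open>k > 0\<close> \<open>k \<noteq> 1\<close> by (auto intro!: mult_pos_pos)
    then show "a < b + c" "b < a + c" "c < a + b" by auto
  qed

  \<comment> \<open>\<open>S\<close> has the sign of \<open>w\<close>, negative for
    \<open>k < 1\<close>; the area is its absolute value.\<close>
  define S where "S = 2 * w * u * (u\<^sup>2 - w\<^sup>2) * (u\<^sup>2 - v\<^sup>2)\<^sup>2"
  have H: "(a + b + c) * (b + c - a) * (a + c - b) * (a + b - c) = (4 * S)\<^sup>2"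
    unfolding F S_def w_def by algebra
  have area: "triangle_area P Q R = \<bar>S\<bar>" if "triangle_with_sides P Q R a b c" for P Q R
    using triangle_area_heron[OF that] unfolding H real_sqrt_abs by simp
  have "S \<noteq> 0"
    using w0 upos D A0 by (simp add: S_def)
  have "S \<in> \<rat>"
    using \<open>k \<in> \<rat>\<close> unfolding S_def u_def v_def w_def by auto

  \<comment> \<open>The sides have degree 4 in \<open>u\<close>, \<open>v\<close>, \<open>w\<close>,
    so \<open>d^4\<close> clears their denominators; \<open>s^2\<close> then removes the common
    factor.\<close>
  define r where "r = d^4 / (real_of_int s)\<^sup>2"
  have r: "r > 0" using d s by (simp add: r_def)
  have "r \<in> \<rat>" by (simp add: r_def d_def)
  have ra: "r * a = real_of_int (x\<^sup>2)"
  proof -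
    have "(real_of_int s * real_of_int x)\<^sup>2 = d^4 * a"
      unfolding rx a by algebra
    then show ?thesis using s by (simp add: r_def field_simps power_mult_distrib)
  qed
  have rc: "r * c = real_of_int (z\<^sup>2)"
  proof -
    have "(real_of_int s * real_of_int z)\<^sup>2 = d^4 * c"
      unfolding rz c by algebra
    then show ?thesis using s by (simp add: r_def field_simps power_mult_distrib)
  qed
  have rb: "r * b = real_of_int y"
    using ry s by (simp add: r_def field_simps)
  have rS: "r\<^sup>2 * S = real_of_int t"
    using rt[folded S_def] s by (simp add: r_def power_divide field_simps)
  have "a > 0" "b > 0" "c > 0"
    using A0 upos vpos D by (auto simp: a b c add_pos_nonneg)
  then have "real_of_int (x\<^sup>2) > 0" "real_of_int y > 0" "real_of_int (z\<^sup>2) > 0"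
    using r unfolding ra[symmetric] rb[symmetric] rc[symmetric] by simp_all
  then have pos: "x\<^sup>2 > 0" "y > 0" "z\<^sup>2 > 0"
    by (simp_all only: of_int_0_less_iff)
  have "t \<noteq> 0" using rS r \<open>S \<noteq> 0\<close> by auto
  have gcd: "Gcd {x\<^sup>2, y, z\<^sup>2} = 1"
  proof -
    have "coprime (x\<^sup>2) (z\<^sup>2)" using \<open>coprime x z\<close> by simp
    then have "gcd (x\<^sup>2) (gcd y (z\<^sup>2)) = 1"
      by (metis coprime_iff_gcd_eq_1 gcd.left_commute gcd_1_int gcd.commute)
    then show ?thesis by simp
  qed
  \<comment> \<open>The same \<open>r\<close>, \<open>x\<close>, \<open>y\<close>, \<open>z\<close>
    serve every triangle with these sides.\<close>
  have "triangle_area P Q R \<in> \<rat> \<and> r \<in> \<rat> \<and> r > 0 \<and>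
      primitive_heron_triangle (r *\<^sub>R P) (r *\<^sub>R Q) (r *\<^sub>R R) (x\<^sup>2) y (z\<^sup>2)"
    if T: "triangle_with_sides P Q R a b c" for P Q R
  proof -
    have "triangle_area (r *\<^sub>R P) (r *\<^sub>R Q) (r *\<^sub>R R) = \<bar>r\<^sup>2 * S\<bar>"
      using triangle_area_scaleR[OF T r] area[OF T] by (simp add: abs_mult)
    then have "triangle_area (r *\<^sub>R P) (r *\<^sub>R Q) (r *\<^sub>R R) = real_of_int \<bar>t\<bar>"
      by (simp add: rS)
    then have "heron_triangle (r *\<^sub>R P) (r *\<^sub>R Q) (r *\<^sub>R R) (x\<^sup>2) y (z\<^sup>2)"
      using triangle_with_sides_scaleR[OF T r, unfolded ra rb rc] pos \<open>t \<noteq> 0\<close>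
      unfolding heron_triangle_def by (metis zero_less_abs_iff)
    then show ?thesis
      using gcd \<open>S \<in> \<rat>\<close> \<open>r \<in> \<rat>\<close> r area[OF T] by (simp add: primitive_heron_triangle_def)
  qed
  with exists show ?thesis by blast
qed

end
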